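(* Let $S=K[x_1,\ldots,x_n]$ be a standard graded polynomial ring over a field $K$ and let $I\subset S$ be a nonzero proper monomial ideal with $\mathrm v(I)=\alpha(I)-1$. If there exist an associated prime $\mathfrak{p}$ of $I$ and a monomial $f\in S$ such that $(I:f)=\mathfrak{p}$, $\deg(f)=\mathrm{v}(I)$, and $x_i\nmid f$ for all $x_i\in\mathcal{G}(\mathfrak{p})$, then $\mathfrak{p}\in\operatorname{Ass}(I^k)$ and $\mathrm v(I^{k})=\mathrm{v}_{\mathfrak{p}}(I^{k})=\alpha(I)k-1$ for all $k\geq 1$.
   Context: $S=\bigoplus_{d\ge 0}S_d$ is graded with $\deg x_i=1$. For a monomial ideal $J$, $\mathcal{G}(J)$ denotes its unique minimal set of monomial generators; associated primes of monomial ideals are generated by variables. $\operatorname{Ass}(I)$ denotes the set of associated primes of $I$ (i.e. of $S/I$). For a nonzero graded ideal $I$, $\alpha(I):=\min\{\deg(f)\mid f\in I\setminus\{0\}\}$ (over homogeneous $f$). For a proper graded ideal $I$ and $\mathfrak{p}\in\operatorname{Ass}(I)$, $\mathrm{v}_{\mathfrak{p}}(I):=\min\{d\geq 0\mid \exists f\in S_d \text{ with } (I:f)=\mathfrak{p}\}$, and $\mathrm{v}(I):=\min\{d\geq 0\mid \exists f\in S_d,\ \mathfrak{p}\in\operatorname{Ass}(I)\text{ with }(I:f)=\mathfrak{p}\}$. Here $(I:f)=\{g\in S\mid gf\in I\}$. *)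

theory Defs
  imports Complex_Main "HOL-Library.Poly_Mapping"
begin

section \<open>Polynomials in finitely many variables\<close>

text \<open>The variables are indexed by a finite type \<open>'n\<close>, so \<open>n = CARD('n)\<close>. A polynomial is a
  finitely supported map from exponent vectors to coefficients; the ring operations are those
  of \<open>Poly_Mapping\<close> (multiplication is convolution).\<close>

type_synonym ('n, 'k) mpoly = "('n \<Rightarrow>\<^sub>0 nat) \<Rightarrow>\<^sub>0 'k"

definition mpvar :: "'n \<Rightarrow> ('n, 'k::field) mpoly" where
  "mpvar i = Poly_Mapping.single (Poly_Mapping.single i 1) 1"

definition is_monomial :: "('n, 'k::field) mpoly \<Rightarrow> bool" where
  "is_monomial f \<longleftrightarrow> (\<exists>t. f = Poly_Mapping.single t 1)"

definition expo_deg :: "('n::finite \<Rightarrow>\<^sub>0 nat) \<Rightarrow> nat" where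
  "expo_deg t = (\<Sum>i\<in>UNIV. Poly_Mapping.lookup t i)"

text \<open>Total degree; the zero polynomial gets degree \<open>0\<close>.\<close>

definition mpdeg :: "('n::finite, 'k::field) mpoly \<Rightarrow> nat" where
  "mpdeg f = Max (insert 0 (expo_deg ` Poly_Mapping.keys f))"

text \<open>The graded component \<open>S\<^sub>d\<close> (which contains \<open>0\<close>).\<close>

definition hom_part :: "nat \<Rightarrow> ('n::finite, 'k::field) mpoly set" where
  "hom_part d = {f. \<forall>t\<in>Poly_Mapping.keys f. expo_deg t = d}"


section \<open>Ideals\<close>

text \<open>Ideals of a commutative ring are its submodules over itself: \<open>ideal.subspace I\<close> says that
  \<open>I\<close> is an ideal, and \<open>ideal.span B\<close> is the ideal generated by \<open>B\<close>.\<close>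

interpretation ideal: module "(*) :: 'a::comm_ring_1 \<Rightarrow> 'a \<Rightarrow> 'a"
  by standard (simp_all add: algebra_simps)

definition is_prime_ideal :: "'a::comm_ring_1 set \<Rightarrow> bool" where
  "is_prime_ideal P \<longleftrightarrow> ideal.subspace P \<and> P \<noteq> UNIV \<and>
     (\<forall>a b. a * b \<in> P \<longrightarrow> a \<in> P \<or> b \<in> P)"

definition ideal_colon :: "'a::comm_ring_1 set \<Rightarrow> 'a \<Rightarrow> 'a set" where
  "ideal_colon I f = {g. g * f \<in> I}"

primrec ideal_power :: "'a::comm_ring_1 set \<Rightarrow> nat \<Rightarrow> 'a set" where
  "ideal_power I 0 = UNIV"
| "ideal_power I (Suc k) = ideal.span {a * b | a b. a \<in> I \<and> b \<in> ideal_power I k}"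

text \<open>\<open>Ass I\<close> is the set of associated primes of the module \<open>S/I\<close>, i.e. the prime ideals that
  are annihilators \<open>(I : g)\<close> of residue classes \<open>g + I\<close>.\<close>

definition Ass :: "'a::comm_ring_1 set \<Rightarrow> 'a set set" where
  "Ass I = {P. is_prime_ideal P \<and> (\<exists>g. P = ideal_colon I g)}"

definition monomial_ideal :: "('n, 'k::field) mpoly set \<Rightarrow> bool" where
  "monomial_ideal I \<longleftrightarrow> (\<exists>B. (\<forall>m\<in>B. is_monomial m) \<and> I = ideal.span B)"

text \<open>The unique inclusion-minimal generating set consisting of monomials; meaningful for
  monomial ideals only.\<close>

definition min_gens :: "('n, 'k::field) mpoly set \<Rightarrow> ('n, 'k) mpoly set" where
  "min_gens J = (THE G. (\<forall>m\<in>G. is_monomial m) \<and> ideal.span G = J \<and>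
     (\<forall>H. H \<subset> G \<longrightarrow> ideal.span H \<noteq> J))"


section \<open>Initial degree and v-numbers\<close>

definition alpha :: "('n::finite, 'k::field) mpoly set \<Rightarrow> nat" where
  "alpha I = (LEAST d. \<exists>f\<in>I - {0}. (\<exists>e. f \<in> hom_part e) \<and> mpdeg f = d)"

definition v_local :: "('n::finite, 'k::field) mpoly set \<Rightarrow> ('n, 'k) mpoly set \<Rightarrow> nat" where
  "v_local P I = (LEAST d. \<exists>f\<in>hom_part d. ideal_colon I f = P)"

definition v_number :: "('n::finite, 'k::field) mpoly set \<Rightarrow> nat" where
  "v_number I = (LEAST d. \<exists>f\<in>hom_part d. \<exists>P\<in>Ass I. ideal_colon I f = P)"

end

theory Submission
  imports Defs
begin

text \<open>Everything rests on a count of variables. For a set \<open>V\<close> of variables, the \<open>d\<close>-th power of the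
  ideal \<open>(x\<^sub>i | i \<in> V)\<close> consists of the polynomials all of whose terms have degree at least \<open>d\<close> in
  the variables of \<open>V\<close> (\<open>var_power V d\<close> below). These filtrations are multiplicative, so
  \<open>I \<subseteq> var_power V a\<close> forces \<open>I\<^sup>k \<subseteq> var_power V (k a)\<close> (\<open>ideal_power_subset_var_power\<close>).
  This is used for two choices of \<open>V\<close>.

  Let \<open>V\<close> be the set of variables in \<open>P\<close>, pick \<open>i \<in> V\<close>, and put \<open>w = f (x\<^sub>i f)\<^sup>k\<^sup>-\<^sup>1\<close>, a monomial of
  degree \<open>k \<alpha>(I) - 1\<close>. As \<open>P f \<subseteq> I\<close> and \<open>x\<^sub>i f \<in> I\<close>, we have \<open>P w \<subseteq> I\<^sup>k\<close>. Conversely, no variable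
  of \<open>V\<close> divides \<open>f\<close>, so \<open>w\<close> has degree only \<open>k - 1\<close> in \<open>V\<close>, whereas \<open>I\<^sup>k \<subseteq> P\<^sup>k\<close> has
  degree at least \<open>k\<close> there; hence every term of a \<open>g\<close> with \<open>g w \<in> I\<^sup>k\<close> contains a variable of
  \<open>V\<close>, and \<open>g \<in> P\<close>. So \<open>(I\<^sup>k : w) = P\<close>, see \<open>colon_witness_power\<close>.

  Taking all variables for \<open>V\<close> gives that the terms in \<open>I\<^sup>k\<close> have degree at least \<open>k \<alpha>(I)\<close>. If
  \<open>(I\<^sup>k : h)\<close> is a prime, it contains \<open>I\<^sup>k\<close>, hence a monomial, hence some variable \<open>x\<^sub>i\<close>;
  then \<open>x\<^sub>i h \<in> I\<^sup>k\<close> shows \<open>deg h \<ge> k \<alpha>(I) - 1\<close>, see \<open>colon_degree_lower_bound\<close>.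

  The hypothesis on \<open>f\<close> mentions the minimal generators of \<open>P\<close>; \<open>min_gens_prime\<close>
  identifies them with the variables in \<open>P\<close>.\<close>


section \<open>Terms of polynomials\<close>

lemma sum_monomials:
  "(\<Sum>t\<in>Poly_Mapping.keys g. Poly_Mapping.single t (Poly_Mapping.lookup g t)) = g"
  by (rule poly_mapping_eqI)
    (auto simp: lookup_sum lookup_single when_def in_keys_iff sum.delta')

lemma mult_eq_single_mult:
  fixes c :: "'k::field"
  shows "Poly_Mapping.single (s + t) c = Poly_Mapping.single s c * Poly_Mapping.single t 1"
  by (simp add: mult_single)

text \<open>Multiplication by a monomial shifts exponents injectively, so no terms cancel.\<close>

lemma lookup_mult_single:
  fixes g :: "('n, 'k::field) mpoly"
  shows "Poly_Mapping.lookup (g * Poly_Mapping.single s 1) (t + s) = Poly_Mapping.lookup g t"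
proof -
  have "g * Poly_Mapping.single s 1 =
      (\<Sum>u\<in>Poly_Mapping.keys g. Poly_Mapping.single (u + s) (Poly_Mapping.lookup g u))"
    by (subst sum_monomials[of g, symmetric]) (simp add: sum_distrib_right mult_single)
  then show ?thesis
    by (auto simp: lookup_sum lookup_single when_def in_keys_iff sum.delta')
qed

lemma keys_mult_single:
  fixes g :: "('n, 'k::field) mpoly"
  shows "t \<in> Poly_Mapping.keys g \<Longrightarrow> t + s \<in> Poly_Mapping.keys (g * Poly_Mapping.single s 1)"
  by (simp add: in_keys_iff lookup_mult_single)

lemma ideal_contains_if_terms:
  fixes J :: "('n, 'k::field) mpoly set"
  assumes "ideal.subspace J" "\<forall>t\<in>Poly_Mapping.keys g. Poly_Mapping.single t 1 \<in> J"
  shows "g \<in> J"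
proof -
  have "Poly_Mapping.single t (Poly_Mapping.lookup g t) \<in> J" if "t \<in> Poly_Mapping.keys g" for t
    using ideal.subspace_scale[OF assms(1), of "Poly_Mapping.single t 1"
        "Poly_Mapping.single 0 (Poly_Mapping.lookup g t)"] assms(2) that
    by (simp add: mult_single)
  then show ?thesis
    using ideal.subspace_sum[OF assms(1)] sum_monomials[of g] by metis
qed

text \<open>The polynomials all of whose terms are multiples of members of \<open>B\<close> already form an ideal.\<close>

lemma span_monomials_term_divisible:
  fixes B :: "('n, 'k::field) mpoly set"
  assumes "\<forall>m\<in>B. is_monomial m" "g \<in> ideal.span B" "t \<in> Poly_Mapping.keys g"
  obtains s u where "Poly_Mapping.single s 1 \<in> B" "t = u + s"
proof -
  let ?M = "{g :: ('n, 'k) mpoly. \<forall>t\<in>Poly_Mapping.keys g.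
    \<exists>s u. Poly_Mapping.single s 1 \<in> B \<and> t = u + s}"
  have sub: "ideal.subspace ?M"
  proof (rule ideal.subspaceI)
    show "0 \<in> ?M" by simp
  next
    fix x y assume "x \<in> ?M" "y \<in> ?M"
    then show "x + y \<in> ?M" using keys_add[of x y] by blast
  next
    fix c x assume x: "x \<in> ?M"
    {
      fix t assume "t \<in> Poly_Mapping.keys (c * x)"
      then obtain a b where "t = a + b" "b \<in> Poly_Mapping.keys x"
        using keys_mult[of c x] by blast
      moreover obtain s u where "Poly_Mapping.single s (1::'k) \<in> B" "b = u + s"
        using x \<open>b \<in> _\<close> by blast
      ultimately have "Poly_Mapping.single s (1::'k) \<in> B \<and> t = (a + u) + s"
        by (simp add: add.assoc)
      then have "\<exists>s u. Poly_Mapping.single s (1::'k) \<in> B \<and> t = u + s" by blast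
    }
    then show "c * x \<in> ?M" by blast
  qed
  have "m \<in> ?M" if "m \<in> B" for m
  proof -
    obtain s where "m = Poly_Mapping.single s 1"
      using assms(1) \<open>m \<in> B\<close> unfolding is_monomial_def by blast
    moreover have "s = 0 + s" by simp
    ultimately show ?thesis using \<open>m \<in> B\<close> by fastforce
  qed
  then have "ideal.span B \<subseteq> ?M" by (intro ideal.span_minimal sub) blast
  then show thesis using assms(2,3) that by blast
qed

lemma monomial_ideal_contains_terms:
  fixes I :: "('n, 'k::field) mpoly set"
  assumes "monomial_ideal I" "g \<in> I" "t \<in> Poly_Mapping.keys g"
  shows "Poly_Mapping.single t 1 \<in> I"
proof -
  obtain B where B: "\<forall>m\<in>B. is_monomial m" "I = ideal.span B"
    using assms(1) unfolding monomial_ideal_def by blast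
  obtain s u where su: "Poly_Mapping.single s (1::'k) \<in> B" "t = u + s"
    using span_monomials_term_divisible[OF B(1)] assms B(2) by blast
  show ?thesis
    unfolding su(2) mult_eq_single_mult B(2) by (intro ideal.span_scale ideal.span_base su(1))
qed

lemma monomial_ideal_subspace: "monomial_ideal I \<Longrightarrow> ideal.subspace I"
  unfolding monomial_ideal_def by auto

text \<open>Colons of monomial ideals by monomials inherit the property of containing each term of
  each of their members. This makes the combinatorial description of \<open>P\<close> possible.\<close>

lemma colon_contains_terms:
  fixes I :: "('n, 'k::field) mpoly set"
  assumes "monomial_ideal I" "is_monomial f" "g \<in> ideal_colon I f" "t \<in> Poly_Mapping.keys g"
  shows "Poly_Mapping.single t 1 \<in> ideal_colon I f"
proof -
  obtain s where s: "f = Poly_Mapping.single s 1"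
    using assms(2) unfolding is_monomial_def by blast
  have "Poly_Mapping.single (t + s) 1 \<in> I"
    using monomial_ideal_contains_terms[OF assms(1)] keys_mult_single[OF assms(4)] assms(3) s
    unfolding ideal_colon_def by blast
  then show ?thesis using s by (simp add: ideal_colon_def mult_single)
qed


section \<open>Degree in a subset of the variables\<close>

definition deg_in :: "'n set \<Rightarrow> ('n::finite \<Rightarrow>\<^sub>0 nat) \<Rightarrow> nat" where
  "deg_in V t = (\<Sum>i\<in>V. Poly_Mapping.lookup t i)"

text \<open>This is the \<open>d\<close>-th power of the ideal generated by the variables in \<open>V\<close>, described by its
  terms rather than as a span, so that membership is a condition on exponents.\<close>

definition var_power :: "'n set \<Rightarrow> nat \<Rightarrow> ('n::finite, 'k::field) mpoly set" where
  "var_power V d = {g. \<forall>t\<in>Poly_Mapping.keys g. d \<le> deg_in V t}"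

lemma deg_in_add: "deg_in V (s + t) = deg_in V s + deg_in V t"
  by (simp add: deg_in_def lookup_add sum.distrib)

lemma deg_in_var: "deg_in V (Poly_Mapping.single i c) = (if i \<in> V then c else 0)"
  by (simp add: deg_in_def lookup_single when_def)

lemma deg_in_pos_iff: "deg_in V t > 0 \<longleftrightarrow> (\<exists>i\<in>V. Poly_Mapping.lookup t i > 0)"
  unfolding deg_in_def neq0_conv[symmetric] by (simp add: sum_eq_0_iff)

lemma expo_deg_eq_deg_in: "expo_deg = deg_in UNIV"
  by (rule ext) (simp add: expo_deg_def deg_in_def)

lemma mpdeg_monomial: "mpdeg (Poly_Mapping.single t (1::'k::field)) = expo_deg t"
  by (simp add: mpdeg_def)

lemma var_power_subspace: "ideal.subspace (var_power V d :: ('n::finite, 'k::field) mpoly set)"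
proof (rule ideal.subspaceI)
  show "0 \<in> var_power V d" by (simp add: var_power_def)
next
  fix x y :: "('n, 'k) mpoly" assume "x \<in> var_power V d" "y \<in> var_power V d"
  then show "x + y \<in> var_power V d" unfolding var_power_def using keys_add[of x y] by blast
next
  fix c x :: "('n, 'k) mpoly" assume "x \<in> var_power V d"
  then show "c * x \<in> var_power V d"
    unfolding var_power_def using keys_mult[of c x] by (fastforce simp: deg_in_add)
qed

lemma var_power_mult:
  assumes "x \<in> var_power V a" "y \<in> var_power V b"
  shows "x * y \<in> var_power V (a + b)"
proof -
  have "a + b \<le> deg_in V t" if t: "t \<in> Poly_Mapping.keys (x * y)" for t
  proof -
    obtain p q where "t = p + q" "p \<in> Poly_Mapping.keys x" "q \<in> Poly_Mapping.keys y"
      using t keys_mult[of x y] by blast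
    then show ?thesis using assms by (auto simp: var_power_def deg_in_add intro: add_mono)
  qed
  then show ?thesis by (simp add: var_power_def)
qed

text \<open>The filtration is multiplicative because degrees in \<open>V\<close> add up. Every lower bound on degrees
  in \<open>I\<^sup>k\<close> below comes from this inclusion.\<close>

lemma ideal_power_subset_var_power:
  assumes "I \<subseteq> var_power V a"
  shows "ideal_power I k \<subseteq> var_power V (k * a)"
proof (induction k)
  case 0
  show ?case by (simp add: var_power_def)
next
  case (Suc k)
  show ?case
    using assms Suc var_power_mult[of _ V a _ "k * a"]
    unfolding ideal_power.simps by (intro ideal.span_minimal var_power_subspace) auto
qed

lemma ideal_power_mult: "a \<in> I \<Longrightarrow> b \<in> ideal_power I k \<Longrightarrow> a * b \<in> ideal_power I (Suc k)"
  by (auto intro!: ideal.span_base)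

lemma power_in_ideal_power: "a \<in> I \<Longrightarrow> a ^ k \<in> ideal_power I k"
proof (induction k)
  case (Suc k)
  then show ?case using ideal_power_mult[of a I "a ^ k" k] by simp
qed simp

lemma ideal_power_subspace: "ideal.subspace (ideal_power I k)"
  by (cases k) simp_all

lemma monomial_power:
  obtains t' where "Poly_Mapping.single t (1::'k::field) ^ k = Poly_Mapping.single t' 1"
    "\<And>V. deg_in V t' = k * deg_in V t"
proof (induction k arbitrary: thesis)
  case 0
  show ?case by (rule 0[of 0]) (simp_all add: deg_in_def)
next
  case (Suc k)
  obtain t' where "Poly_Mapping.single t (1::'k) ^ k = Poly_Mapping.single t' 1"
    "\<And>V. deg_in V t' = k * deg_in V t" using Suc.IH by blast
  then show ?case by (intro Suc.prems[of "t + t'"]) (simp_all add: mult_single deg_in_add)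
qed

lemma monomial_ideal_subset_var_power_alpha:
  fixes I :: "('n::finite, 'k::field) mpoly set"
  assumes "monomial_ideal I"
  shows "I \<subseteq> var_power UNIV (alpha I)"
proof
  fix g assume g: "g \<in> I"
  have "alpha I \<le> deg_in UNIV t" if t: "t \<in> Poly_Mapping.keys g" for t
  proof -
    let ?m = "Poly_Mapping.single t (1::'k)"
    have "?m \<in> I - {0}" "?m \<in> hom_part (expo_deg t)"
      using monomial_ideal_contains_terms[OF assms g t]
      by (auto simp: hom_part_def simp flip: keys_eq_empty)
    then show ?thesis
      unfolding alpha_def expo_deg_eq_deg_in[symmetric]
      by (intro Least_le bexI[of _ ?m] conjI exI[of _ "expo_deg t"]) (simp_all add: mpdeg_monomial)
  qed
  then show "g \<in> var_power UNIV (alpha I)" by (simp add: var_power_def)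
qed


section \<open>Variables in prime ideals\<close>

lemma prime_ideal_one: "is_prime_ideal Q \<Longrightarrow> 1 \<notin> Q"
  unfolding is_prime_ideal_def using ideal.subspace_scale[of Q 1] by fastforce

lemma prime_ideal_power:
  assumes "is_prime_ideal Q" "a ^ k \<in> Q"
  shows "a \<in> Q"
  using assms(2)
proof (induction k)
  case 0
  then show ?case using prime_ideal_one[OF assms(1)] by simp
next
  case (Suc k)
  then show ?case using assms(1) unfolding is_prime_ideal_def by auto
qed

lemma monomial_split_var:
  fixes t :: "'n \<Rightarrow>\<^sub>0 nat"
  assumes "Poly_Mapping.lookup t i > 0"
  obtains u where "t = Poly_Mapping.single i 1 + u"
proof (rule that)
  show "t = Poly_Mapping.single i 1 + (t - Poly_Mapping.single i 1)"
    by (rule poly_mapping_eqI)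
      (use assms in \<open>auto simp: lookup_add lookup_minus lookup_single when_def\<close>)
qed

lemma mpvar_mult_single:
  "mpvar i * Poly_Mapping.single u (1::'k::field)
     = Poly_Mapping.single (Poly_Mapping.single i 1 + u) 1"
  by (simp add: mpvar_def mult_single)

text \<open>A monomial is a product of variables, and a prime ideal contains one of the factors.\<close>

lemma prime_ideal_monomial_var:
  fixes Q :: "('n::finite, 'k::field) mpoly set"
  assumes "is_prime_ideal Q" "Poly_Mapping.single t 1 \<in> Q"
  shows "\<exists>i. mpvar i \<in> Q \<and> Poly_Mapping.lookup t i > 0"
  using assms(2)
proof (induction "expo_deg t" arbitrary: t rule: less_induct)
  case less
  have "t \<noteq> 0"
  proof
    assume "t = 0"
    then show False using less.prems prime_ideal_one[OF assms(1)] by simp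
  qed
  then obtain i where i: "Poly_Mapping.lookup t i > 0"
    by (metis lookup_zero neq0_conv poly_mapping_eqI)
  then obtain u where u: "t = Poly_Mapping.single i 1 + u" by (rule monomial_split_var)
  have "mpvar i * Poly_Mapping.single u 1 \<in> Q"
    using less.prems u mpvar_mult_single[of i u, where 'k = 'k] by simp
  then consider "mpvar i \<in> Q" | "Poly_Mapping.single u 1 \<in> Q"
    using assms(1) unfolding is_prime_ideal_def by blast
  then show ?case
  proof cases
    case 1
    then show ?thesis using i by blast
  next
    case 2
    have "expo_deg u < expo_deg t"
      using u by (simp add: expo_deg_eq_deg_in deg_in_add deg_in_var)
    from less.hyps[OF this 2] show ?thesis using u by (auto simp: lookup_add)
  qed
qed

lemma prime_ideal_monomial_iff:
  fixes Q :: "('n::finite, 'k::field) mpoly set"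
  assumes "is_prime_ideal Q"
  shows "Poly_Mapping.single t 1 \<in> Q \<longleftrightarrow> deg_in {i. mpvar i \<in> Q} t > 0"
proof
  assume "Poly_Mapping.single t 1 \<in> Q"
  then show "deg_in {i. mpvar i \<in> Q} t > 0"
    using prime_ideal_monomial_var[OF assms] by (auto simp: deg_in_pos_iff)
next
  assume "deg_in {i. mpvar i \<in> Q} t > 0"
  then obtain i where i: "mpvar i \<in> Q" "Poly_Mapping.lookup t i > 0"
    by (auto simp: deg_in_pos_iff)
  then obtain u where u: "t = Poly_Mapping.single i 1 + u" using monomial_split_var by metis
  have "Poly_Mapping.single u 1 * mpvar i \<in> Q"
    using assms i(1) ideal.subspace_scale unfolding is_prime_ideal_def by blast
  then show "Poly_Mapping.single t 1 \<in> Q"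
    unfolding u mpvar_mult_single[symmetric] by (simp add: mult.commute)
qed

text \<open>A variable is divisible by no monomials other than \<open>1\<close> and itself. So a set of monomials
  that generates a proper ideal contains every variable of that ideal.\<close>

lemma var_in_monomial_generators:
  fixes H :: "('n::finite, 'k::field) mpoly set"
  assumes "\<forall>m\<in>H. is_monomial m" "1 \<notin> ideal.span H" "mpvar i \<in> ideal.span H"
  shows "mpvar i \<in> H"
proof -
  have "Poly_Mapping.single i 1 \<in> Poly_Mapping.keys (mpvar i :: ('n, 'k) mpoly)"
    by (simp add: mpvar_def)
  then obtain s u where s: "Poly_Mapping.single s (1::'k) \<in> H"
    and su: "Poly_Mapping.single i 1 = u + s"
    using span_monomials_term_divisible[OF assms(1,3)] by blast
  have "s \<noteq> 0" using s assms(2) ideal.span_base by fastforce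
  then obtain j where j: "Poly_Mapping.lookup s j > 0"
    by (metis lookup_zero neq0_conv poly_mapping_eqI)
  have eq: "Poly_Mapping.lookup u l + Poly_Mapping.lookup s l = (if l = i then 1 else 0)" for l
    using arg_cong[OF su, of "\<lambda>p. Poly_Mapping.lookup p l"]
    by (auto simp: lookup_add lookup_single when_def)
  have "j = i" using eq[of j] j by (simp split: if_splits)
  have "Poly_Mapping.lookup s l = Poly_Mapping.lookup (Poly_Mapping.single i 1) l" for l
    using eq[of l] j \<open>j = i\<close> by (cases "l = i") (auto simp: lookup_single when_def)
  then have "s = Poly_Mapping.single i 1" by (rule poly_mapping_eqI)
  then show ?thesis using s by (simp add: mpvar_def)
qed

text \<open>The variables in \<open>Q\<close> generate \<open>Q\<close>, since every term of a member is divisible by one of them.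
  Every monomial generating set of \<open>Q\<close> contains these variables; so they form the only minimal
  one, as the definite description in \<open>min_gens\<close> demands.\<close>

lemma min_gens_prime:
  fixes Q :: "('n::finite, 'k::field) mpoly set"
  assumes prime: "is_prime_ideal Q"
    and terms: "\<And>g t. g \<in> Q \<Longrightarrow> t \<in> Poly_Mapping.keys g \<Longrightarrow> Poly_Mapping.single t 1 \<in> Q"
  shows "min_gens Q = {mpvar i | i. mpvar i \<in> Q}"
proof -
  let ?G = "{mpvar i | i. mpvar i \<in> Q}"
  have mono: "\<forall>m\<in>?G. is_monomial m" by (auto simp: is_monomial_def mpvar_def)
  have sub: "ideal.subspace Q" using prime unfolding is_prime_ideal_def by blast
  have in_gens: "?G \<subseteq> H" if "\<forall>m\<in>H. is_monomial m" "ideal.span H = Q" for H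
    using that var_in_monomial_generators[of H] prime_ideal_one[OF prime] by auto
  have span: "ideal.span ?G = Q"
  proof (rule ideal.span_subspace)
    show "Q \<subseteq> ideal.span ?G"
    proof
      fix g assume g: "g \<in> Q"
      have "Poly_Mapping.single t 1 \<in> ideal.span ?G" if t: "t \<in> Poly_Mapping.keys g" for t
      proof -
        obtain i where i: "mpvar i \<in> Q" "Poly_Mapping.lookup t i > 0"
          using prime_ideal_monomial_var[OF prime terms[OF g t]] by blast
        then obtain u where u: "t = Poly_Mapping.single i 1 + u" using monomial_split_var by metis
        have "Poly_Mapping.single u 1 * mpvar i \<in> ideal.span ?G"
          using i(1) by (intro ideal.span_scale ideal.span_base) blast
        then show ?thesis unfolding u mpvar_mult_single[symmetric] by (simp add: mult.commute)
      qed
      then show "g \<in> ideal.span ?G" using ideal_contains_if_terms by blast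
    qed
  qed (use sub in auto)
  have minimal: "ideal.span H \<noteq> Q" if "H \<subset> ?G" for H
    using in_gens[of H] that mono by blast
  show ?thesis
    unfolding min_gens_def
  proof (rule the_equality)
    show "(\<forall>m\<in>?G. is_monomial m) \<and> ideal.span ?G = Q \<and>
        (\<forall>H. H \<subset> ?G \<longrightarrow> ideal.span H \<noteq> Q)"
      using mono span minimal by blast
  next
    fix G assume "(\<forall>m\<in>G. is_monomial m) \<and> ideal.span G = Q \<and>
        (\<forall>H. H \<subset> G \<longrightarrow> ideal.span H \<noteq> Q)"
    then show "G = ?G" using in_gens[of G] span by blast
  qed
qed

lemma monomial_not_divisible_deg_in:
  assumes "\<And>i. i \<in> V \<Longrightarrow> \<not> mpvar i dvd Poly_Mapping.single s (1::'k::field)"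
  shows "deg_in V s = 0"
proof -
  have "Poly_Mapping.lookup s i = 0" if "i \<in> V" for i
  proof (rule ccontr)
    assume "Poly_Mapping.lookup s i \<noteq> 0"
    then have "Poly_Mapping.lookup s i > 0" by simp
    then obtain u where "s = Poly_Mapping.single i 1 + u" by (rule monomial_split_var)
    then have "mpvar i dvd Poly_Mapping.single s (1::'k)"
      by (metis dvd_triv_left mpvar_mult_single)
    then show False using assms that by blast
  qed
  then show ?thesis by (simp add: deg_in_def)
qed

lemma prime_over_power: "is_prime_ideal Q \<Longrightarrow> ideal_power I k \<subseteq> Q \<Longrightarrow> I \<subseteq> Q"
  by (meson power_in_ideal_power prime_ideal_power subset_iff)

lemma prime_over_monomial_ideal_contains_var:
  fixes I Q :: "('n::finite, 'k::field) mpoly set"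
  assumes "monomial_ideal I" "I \<noteq> {0}" "is_prime_ideal Q" "I \<subseteq> Q"
  shows "\<exists>i. mpvar i \<in> Q"
proof -
  obtain g where g: "g \<in> I" "g \<noteq> 0"
    using assms(2) ideal.subspace_0[OF monomial_ideal_subspace[OF assms(1)]] by blast
  then obtain t where "t \<in> Poly_Mapping.keys g"
    by (metis lookup_zero not_in_keys_iff_lookup_eq_zero poly_mapping_eqI)
  then have "Poly_Mapping.single t 1 \<in> Q"
    using monomial_ideal_contains_terms assms(1,4) g(1) by blast
  then show ?thesis using prime_ideal_monomial_var[OF assms(3)] by blast
qed


section \<open>The v-number of a power\<close>

lemma ideal_subset_colon: "ideal.subspace J \<Longrightarrow> J \<subseteq> ideal_colon J h"
  unfolding ideal_colon_def using ideal.subspace_scale[of J] by (auto simp: mult.commute)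

text \<open>The prime contains a variable \<open>x\<^sub>i\<close> because it contains \<open>I\<^sup>k\<close>, and \<open>x\<^sub>i h \<in> I\<^sup>k\<close> is nonzero of
  degree \<open>d + 1\<close>.\<close>

lemma colon_degree_lower_bound:
  fixes I :: "('n::finite, 'k::field) mpoly set"
  assumes "monomial_ideal I" "I \<noteq> {0}"
    and h: "h \<in> hom_part d" and prime: "is_prime_ideal (ideal_colon (ideal_power I k) h)"
  shows "k * alpha I \<le> d + 1"
proof -
  let ?J = "ideal_power I k"
  obtain i where "mpvar i \<in> ideal_colon ?J h"
    using prime_over_monomial_ideal_contains_var[OF assms(1,2) prime]
      prime_over_power[OF prime ideal_subset_colon[OF ideal_power_subspace]] by blast
  then have "h * mpvar i \<in> ?J" by (simp add: ideal_colon_def mult.commute)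
  then have low: "h * mpvar i \<in> var_power UNIV (k * alpha I)"
    using ideal_power_subset_var_power[OF monomial_ideal_subset_var_power_alpha[OF assms(1)]]
    by blast
  \<comment> \<open>The colon ideal by \<open>0\<close> is the whole ring, which is not prime.\<close>
  have "h \<noteq> 0"
    using prime_ideal_one[OF prime] ideal.subspace_0[OF ideal_power_subspace[of I k]]
    by (auto simp: ideal_colon_def)
  then obtain t where t: "t \<in> Poly_Mapping.keys h"
    by (metis lookup_zero not_in_keys_iff_lookup_eq_zero poly_mapping_eqI)
  have "k * alpha I \<le> deg_in UNIV (t + Poly_Mapping.single i 1)"
    using low keys_mult_single[OF t] unfolding mpvar_def var_power_def by blast
  moreover have "deg_in UNIV t = d"
    using h t by (simp add: hom_part_def expo_deg_eq_deg_in)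
  ultimately show ?thesis by (simp add: deg_in_add deg_in_var)
qed

text \<open>The witness \<open>w = f (x\<^sub>i f)\<^sup>m\<close>, where \<open>f\<close> has exponent vector \<open>s\<close>, works for two reasons. It
  spends one factor \<open>f\<close> to move \<open>P\<close> into \<open>I\<close> and \<open>m\<close> factors \<open>x\<^sub>i f \<in> I\<close> to reach
  \<open>I\<^sup>m\<^sup>+\<^sup>1\<close>. Its degree in the variables of \<open>P\<close> is only \<open>m\<close>, one less than
  membership in \<open>I\<^sup>m\<^sup>+\<^sup>1 \<subseteq> P\<^sup>m\<^sup>+\<^sup>1\<close> requires, so a cofactor \<open>g\<close> has to
  supply one more such variable in each of its terms.\<close>

lemma colon_witness_power:
  fixes I P :: "('n::finite, 'k::field) mpoly set"
  assumes "monomial_ideal I" and prime: "is_prime_ideal P"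
    and colon: "ideal_colon I (Poly_Mapping.single s 1) = P"
    and i: "mpvar i \<in> P" and zero: "deg_in {j. mpvar j \<in> P} s = 0"
  shows "\<exists>w\<in>hom_part (m + Suc m * expo_deg s). ideal_colon (ideal_power I (Suc m)) w = P"
proof -
  let ?V = "{j. mpvar j \<in> P}" and ?f = "Poly_Mapping.single s (1::'k)"
  let ?u = "Poly_Mapping.single i 1 + s"
  obtain t' where t': "Poly_Mapping.single ?u (1::'k) ^ m = Poly_Mapping.single t' 1"
    "\<And>V. deg_in V t' = m * deg_in V ?u" by (rule monomial_power[of ?u m]) blast
  define w where "w = ?f * Poly_Mapping.single ?u 1 ^ m"
  have w: "w = Poly_Mapping.single (s + t') 1" unfolding w_def t'(1) by (simp add: mult_single)
  have hom: "w \<in> hom_part (m + Suc m * expo_deg s)"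
    by (simp add: w hom_part_def expo_deg_eq_deg_in deg_in_add deg_in_var t' algebra_simps)
  have wV: "deg_in ?V (s + t') = m"
    using zero i by (simp add: deg_in_add deg_in_var t')
  have u: "Poly_Mapping.single ?u 1 \<in> I"
    using i unfolding colon[symmetric] ideal_colon_def mem_Collect_eq mpvar_mult_single .
  have terms: "Poly_Mapping.single t 1 \<in> P" if "g \<in> P" "t \<in> Poly_Mapping.keys g" for g t
    using colon_contains_terms[of I ?f] assms(1) that colon by (auto simp: is_monomial_def)
  have "I \<subseteq> P"
    using ideal_subset_colon[OF monomial_ideal_subspace[OF assms(1)]] colon by blast
  moreover have "P \<subseteq> var_power ?V 1"
    using terms prime_ideal_monomial_iff[OF prime] by (fastforce simp: var_power_def)
  ultimately have IV: "ideal_power I (Suc m) \<subseteq> var_power ?V (Suc m)"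
    using ideal_power_subset_var_power[of I ?V 1 "Suc m"] by (simp del: ideal_power.simps)
  have "g \<in> ideal_colon (ideal_power I (Suc m)) w \<longleftrightarrow> g \<in> P" for g
  proof
    assume "g \<in> P"
    then have "g * ?f \<in> I" using colon by (auto simp: ideal_colon_def)
    then have "(g * ?f) * Poly_Mapping.single ?u 1 ^ m \<in> ideal_power I (Suc m)"
      by (intro ideal_power_mult power_in_ideal_power u)
    then show "g \<in> ideal_colon (ideal_power I (Suc m)) w"
      by (simp only: ideal_colon_def w_def mem_Collect_eq mult.assoc)
  next
    assume "g \<in> ideal_colon (ideal_power I (Suc m)) w"
    then have low: "g * w \<in> var_power ?V (Suc m)" using IV unfolding ideal_colon_def by blast
    have "Poly_Mapping.single t 1 \<in> P" if "t \<in> Poly_Mapping.keys g" for t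
    proof -
      have "Suc m \<le> deg_in ?V (t + (s + t'))"
        using low keys_mult_single[OF that] unfolding w var_power_def by blast
      then have "deg_in ?V t > 0" using wV deg_in_add[of ?V t "s + t'"] by linarith
      then show ?thesis using prime_ideal_monomial_iff[OF prime] by blast
    qed
    then show "g \<in> P"
      using ideal_contains_if_terms prime unfolding is_prime_ideal_def by blast
  qed
  then show ?thesis using hom by blast
qed

theorem theorem4p6:
  fixes I P :: "('n::finite, 'k::field) mpoly set"
    and f :: "('n, 'k) mpoly"
  assumes "monomial_ideal I" and "I \<noteq> {0}" and "I \<noteq> UNIV"
    and "int (v_number I) = int (alpha I) - 1"
    and "P \<in> Ass I"
    and "is_monomial f"
    and "ideal_colon I f = P"
    and "mpdeg f = v_number I"
    and "\<forall>i. mpvar i \<in> min_gens P \<longrightarrow> \<not> mpvar i dvd f"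
  shows "\<forall>k\<ge>1. P \<in> Ass (ideal_power I k) \<and>
           v_number (ideal_power I k) = v_local P (ideal_power I k) \<and>
           int (v_local P (ideal_power I k)) = int (alpha I) * int k - 1"
proof (intro allI impI)
  fix k :: nat assume "k \<ge> 1"
  then obtain m where k: "k = Suc m" by (cases k) auto
  let ?J = "ideal_power I k"
  have prime: "is_prime_ideal P" using assms(5) by (simp add: Ass_def)
  obtain s where s: "f = Poly_Mapping.single s 1"
    using assms(6) unfolding is_monomial_def by blast
  \<comment> \<open>The hypothesis \<open>v(I) = \<alpha>(I) - 1\<close> fixes the degree of \<open>f\<close>, which makes the degree of the
    witness meet the lower bound.\<close>
  have alpha: "alpha I = Suc (expo_deg s)" using assms(4,8) s by (simp add: mpdeg_monomial)
  have "I \<subseteq> P"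
    using ideal_subset_colon[OF monomial_ideal_subspace[OF assms(1)]] assms(7) by blast
  then obtain i where i: "mpvar i \<in> P"
    using prime_over_monomial_ideal_contains_var[OF assms(1,2) prime] by blast
  have gens: "min_gens P = {mpvar j | j. mpvar j \<in> P}"
    using colon_contains_terms[OF assms(1,6)] assms(7) by (intro min_gens_prime prime) blast
  have "deg_in {j. mpvar j \<in> P} s = 0"
    using assms(9) gens s by (intro monomial_not_divisible_deg_in[where 'k = 'k]) blast
  then obtain w where w: "w \<in> hom_part (m + Suc m * expo_deg s)" "ideal_colon ?J w = P"
    using colon_witness_power[OF assms(1) prime _ i, of s m] assms(7) s k by blast
  have Ass: "P \<in> Ass ?J" using prime w(2) by (auto simp: Ass_def)
  let ?d = "m + Suc m * expo_deg s"
  have d: "?d + 1 = k * alpha I" by (simp add: alpha k algebra_simps)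
  have lower: "?d \<le> e" if "h \<in> hom_part e" "ideal_colon ?J h \<in> Ass ?J" for e h
    using colon_degree_lower_bound[OF assms(1,2) that(1)] that(2) d by (fastforce simp: Ass_def)
  have "v_local P ?J = ?d"
    unfolding v_local_def using w Ass lower by (intro Least_equality) auto
  moreover have "v_number ?J = ?d"
    unfolding v_number_def using w Ass lower by (intro Least_equality) auto
  moreover have "int ?d = int (alpha I) * int k - 1"
    using arg_cong[OF d, of int] by (simp add: mult.commute)
  ultimately show "P \<in> Ass ?J \<and> v_number ?J = v_local P ?J \<and>
      int (v_local P ?J) = int (alpha I) * int k - 1"
    using Ass by simp
qed

end
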